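(* For any connected graph $G$, $\gamma_P(G)=\gamma(G)$ if and only if $\operatorname{pt}_{\rm pd}(G)=1$. Moreover, in this case $\operatorname{th}_{\rm pd}^{\times}(G)=\gamma(G)$.
   Context: All graphs are finite, simple and undirected with at least one vertex. Let $G$ be a graph. $\gamma(G)$ is the domination number: the minimum $|S|$ over $S\subseteq V(G)$ with $N[S]=V(G)$, where $N[S]$ is the closed neighborhood of $S$. For nonempty $S\subseteq V(G)$ define $P^{[0]}(S)=S$, $P^{[1]}(S)=N[S]$, and for $i\ge 1$, $P^{[i+1]}(S)=P^{[i]}(S)\cup\{w\in V(G)\setminus P^{[i]}(S): \exists u\in P^{[i]}(S),\ N(u)\setminus P^{[i]}(S)=\{w\}\}$. $S$ is a power dominating set if $P^{[t]}(S)=V(G)$ for some $t$; the power domination number $\gamma_P(G)$ is the minimum cardinality of a power dominating set. The power propagation time of $S$, $\operatorname{pt}_{\rm pd}(G;S)$, is the least positive integer $t$ with $P^{[t]}(S)=V(G)$ (so it is at least $1$, even for $S=V(G)$), and is $\infty$ if $S$ is not a power dominating set. The power propagation time of $G$ is $\operatorname{pt}_{\rm pd}(G)=\min\{\operatorname{pt}_{\rm pd}(G;S): |S|=\gamma_P(G)\}$. The product power throttling number is $\operatorname{th}_{\rm pd}^{\times}(G)=\min_{\emptyset\ne S\subseteq V(G)}|S|\operatorname{pt}_{\rm pd}(G;S)$. *)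

theory Defs
  imports "Graph_Theory.Digraph_Component"
begin

text \<open>
  As in \<^theory>\<open>Graph_Theory.Digraph\<close>, a finite simple undirected graph is a finite symmetric
  digraph without loops or parallel arcs (locale \<^locale>\<open>graph\<close>). The empty graph is allowed
  there, but \<^const>\<open>connected\<close> excludes it. Every minimum below is then taken over a finite set,
  which is nonempty because the whole vertex set is dominating.
\<close>

definition nbhd :: "('a, 'b) pre_digraph \<Rightarrow> 'a \<Rightarrow> 'a set" where
  "nbhd G u = {v. u \<rightarrow>\<^bsub>G\<^esub> v}"

definition closed_nbhd :: "('a, 'b) pre_digraph \<Rightarrow> 'a set \<Rightarrow> 'a set" where
  "closed_nbhd G S = S \<union> (\<Union>u\<in>S. nbhd G u)"

definition dominating_set :: "('a, 'b) pre_digraph \<Rightarrow> 'a set \<Rightarrow> bool" where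
  "dominating_set G S \<longleftrightarrow> S \<subseteq> verts G \<and> closed_nbhd G S = verts G"

definition domination_number :: "('a, 'b) pre_digraph \<Rightarrow> nat" where
  "domination_number G = Min (card ` {S. dominating_set G S})"

text \<open>\<open>power_step G S i\<close> is the set $P^{[i]}(S)$.\<close>

fun power_step :: "('a, 'b) pre_digraph \<Rightarrow> 'a set \<Rightarrow> nat \<Rightarrow> 'a set" where
  "power_step G S 0 = S"
| "power_step G S (Suc 0) = closed_nbhd G S"
| "power_step G S (Suc (Suc i)) =
     power_step G S (Suc i) \<union>
     {w \<in> verts G - power_step G S (Suc i).
        \<exists>u \<in> power_step G S (Suc i). nbhd G u - power_step G S (Suc i) = {w}}"

definition power_dominating_set :: "('a, 'b) pre_digraph \<Rightarrow> 'a set \<Rightarrow> bool" where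
  "power_dominating_set G S \<longleftrightarrow>
     S \<noteq> {} \<and> S \<subseteq> verts G \<and> (\<exists>t. power_step G S t = verts G)"

definition power_domination_number :: "('a, 'b) pre_digraph \<Rightarrow> nat" where
  "power_domination_number G = Min (card ` {S. power_dominating_set G S})"

text \<open>
  The time is positive even for \<open>S = verts G\<close>. If \<open>S\<close> is power dominating, some positive \<open>t\<close>
  qualifies, as \<open>power_step G (verts G) (Suc 0) = verts G\<close> in a graph.
\<close>

definition propagation_time_of :: "('a, 'b) pre_digraph \<Rightarrow> 'a set \<Rightarrow> enat" where
  "propagation_time_of G S =
     (if power_dominating_set G S
      then enat (LEAST t. 0 < t \<and> power_step G S t = verts G) else \<infinity>)"

definition propagation_time :: "('a, 'b) pre_digraph \<Rightarrow> enat" where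
  "propagation_time G =
     Min (propagation_time_of G ` {S. S \<subseteq> verts G \<and> card S = power_domination_number G})"

definition product_power_throttling_number :: "('a, 'b) pre_digraph \<Rightarrow> enat" where
  "product_power_throttling_number G =
     Min ((\<lambda>S. enat (card S) * propagation_time_of G S) ` {S. S \<noteq> {} \<and> S \<subseteq> verts G})"

end

theory Submission
  imports Defs
begin

text \<open>
  A nonempty set dominates iff it has propagation time 1, so \<open>\<gamma>\<^sub>P \<le> \<gamma>\<close>, and equality holds iff some
  power dominating set of size \<open>\<gamma>\<^sub>P\<close> is dominating. In that case every power dominating set \<open>S\<close>
  satisfies \<open>card S * pt S \<ge> \<gamma>\<^sub>P * 1 = \<gamma>\<close>, and a minimum dominating set attains \<open>\<gamma>\<close>.
\<close>

lemma (in fin_digraph) finite_dominating_sets: "finite {S. dominating_set G S}"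
  by (rule finite_subset[of _ "Pow (verts G)"]) (auto simp: dominating_set_def)

lemma (in fin_digraph) finite_power_dominating_sets: "finite {S. power_dominating_set G S}"
  by (rule finite_subset[of _ "Pow (verts G)"]) (auto simp: power_dominating_set_def)

lemma (in wf_digraph) closed_nbhd_verts: "closed_nbhd G (verts G) = verts G"
  by (auto simp: closed_nbhd_def nbhd_def)

text \<open>The closed neighborhood of \<open>{}\<close> is \<open>{}\<close>, which equals
  \<open>verts G\<close> only in the empty graph.\<close>

lemma dominating_set_nonempty:
  "dominating_set G S \<Longrightarrow> verts G \<noteq> {} \<Longrightarrow> S \<noteq> {}"
  by (auto simp: dominating_set_def closed_nbhd_def)

text \<open>Step 1 of the propagation is the closed neighborhood, so \<open>t = 1\<close> is a
  witness.\<close>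

lemma dominating_imp_power_dominating:
  assumes "dominating_set G S" "verts G \<noteq> {}"
  shows "power_dominating_set G S"
proof -
  have "power_step G S 1 = verts G"
    using assms(1) by (simp add: dominating_set_def)
  then show ?thesis
    using assms(1) dominating_set_nonempty[OF assms]
    unfolding power_dominating_set_def dominating_set_def by blast
qed

text \<open>\<open>Min\<close> is attained on a finite nonempty set, and \<open>verts G\<close> is
  always a dominating set.\<close>

lemma (in fin_digraph) minimum_dominating_set:
  obtains S where "dominating_set G S" "card S = domination_number G"
proof -
  have "dominating_set G (verts G)"
    by (simp add: dominating_set_def closed_nbhd_verts)
  then have "domination_number G \<in> card ` {S. dominating_set G S}"
    unfolding domination_number_def by (intro Min_in) (auto simp: finite_dominating_sets)
  then show thesis using that by auto
qed

lemma (in fin_digraph) domination_number_le: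
  "dominating_set G S \<Longrightarrow> domination_number G \<le> card S"
  unfolding domination_number_def by (intro Min_le) (auto simp: finite_dominating_sets)

lemma (in fin_digraph) power_domination_number_le:
  "power_dominating_set G S \<Longrightarrow> power_domination_number G \<le> card S"
  unfolding power_domination_number_def
  by (intro Min_le) (auto simp: finite_power_dominating_sets)

lemma (in fin_digraph) power_domination_number_le_domination_number:
  assumes "verts G \<noteq> {}"
  shows "power_domination_number G \<le> domination_number G"
proof -
  obtain S where "dominating_set G S" "card S = domination_number G"
    by (rule minimum_dominating_set)
  then show ?thesis
    using power_domination_number_le dominating_imp_power_dominating assms by fastforce
qed

text \<open>Replaces the \<open>LEAST\<close> by a concrete time. What must be shown is that a
  positive time exists, since \<open>power_dominating_set\<close> also accepts
  \<open>t = 0\<close>.\<close>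

lemma (in wf_digraph) propagation_time_of_steps:
  assumes "power_dominating_set G S"
  obtains t where "propagation_time_of G S = enat t" "0 < t" "power_step G S t = verts G"
proof -
  obtain t where t: "power_step G S t = verts G"
    using assms by (auto simp: power_dominating_set_def)
  have "\<exists>t. 0 < t \<and> power_step G S t = verts G"
  proof (cases t)
    \<comment> \<open>Here \<open>S = verts G\<close>, and one more step leaves the full vertex set
      unchanged.\<close>
    case 0
    then have "power_step G S (Suc 0) = verts G"
      using t by (simp add: closed_nbhd_verts)
    then show ?thesis by blast
  qed (use t in blast)
  from LeastI_ex[OF this] show thesis
    using that assms by (simp add: propagation_time_of_def)
qed

lemma (in wf_digraph) one_le_propagation_time_of: "1 \<le> propagation_time_of G S"
proof (cases "power_dominating_set G S")
  case True
  from propagation_time_of_steps[OF this] obtain t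
    where "propagation_time_of G S = enat t" "0 < t" .
  then show ?thesis
    by (simp add: one_enat_def)
qed (simp add: propagation_time_of_def)

text \<open>Time 1 means that the closed neighborhood of \<open>S\<close> is everything. In the
  empty graph \<open>{}\<close> would be dominating but not power dominating, with time
  \<open>\<infinity>\<close>; the assumption excludes this case.\<close>

lemma (in wf_digraph) propagation_time_of_eq_1_iff:
  assumes "verts G \<noteq> {}"
  shows "propagation_time_of G S = 1 \<longleftrightarrow> dominating_set G S"
proof
  assume 1: "propagation_time_of G S = 1"
  then have pds: "power_dominating_set G S"
    by (auto simp: propagation_time_of_def split: if_splits)
  from propagation_time_of_steps[OF this] obtain t
    where "propagation_time_of G S = enat t" "power_step G S t = verts G" .
  with 1 have "power_step G S 1 = verts G"
    by (simp add: one_enat_def)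
  with pds show "dominating_set G S"
    by (simp add: dominating_set_def power_dominating_set_def)
next
  assume dom: "dominating_set G S"
  have "(LEAST t. 0 < t \<and> power_step G S t = verts G) = 1"
    using dom by (intro Least_equality) (auto simp: dominating_set_def)
  then show "propagation_time_of G S = 1"
    using dominating_imp_power_dominating[OF dom assms]
    by (simp add: propagation_time_of_def one_enat_def)
qed

lemma (in fin_digraph) propagation_time_eq_1_iff:
  assumes "verts G \<noteq> {}"
  shows "propagation_time G = 1 \<longleftrightarrow>
    (\<exists>S. dominating_set G S \<and> card S = power_domination_number G)"
proof -
  let ?F = "{S. S \<subseteq> verts G \<and> card S = power_domination_number G}"
  \<comment> \<open>This bound makes the family \<open>?F\<close> nonempty, so that its
    \<open>Min\<close> is meaningful.\<close>
  have "power_domination_number G \<le> card (verts G)"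
    using assms by (intro power_domination_number_le dominating_imp_power_dominating)
      (auto simp: dominating_set_def closed_nbhd_verts)
  then obtain T where "T \<subseteq> verts G" "card T = power_domination_number G"
    by (rule obtain_subset_with_card_n)
  then have ne: "?F \<noteq> {}"
    by blast
  have fin: "finite ?F"
    by (rule finite_subset[of _ "Pow (verts G)"]) auto
  \<comment> \<open>All times are at least 1, so the minimum is 1 exactly when some member of
    \<open>?F\<close> attains it.\<close>
  have "propagation_time G = 1 \<longleftrightarrow> 1 \<in> propagation_time_of G ` ?F"
    unfolding propagation_time_def
    using ne fin by (subst Min_eq_iff) (auto simp: one_le_propagation_time_of)
  also have "\<dots> \<longleftrightarrow> (\<exists>S\<in>?F. propagation_time_of G S = 1)"
    by (simp add: image_iff eq_commute[of 1])
  also have "\<dots> \<longleftrightarrow> (\<exists>S. dominating_set G S \<and> card S = power_domination_number G)"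
    by (auto simp: propagation_time_of_eq_1_iff[OF assms] dominating_set_def)
  finally show ?thesis .
qed

lemma (in fin_digraph) power_domination_number_le_card_times_propagation_time_of:
  assumes "S \<noteq> {}" "S \<subseteq> verts G"
  shows "enat (power_domination_number G) \<le> enat (card S) * propagation_time_of G S"
proof (cases "power_dominating_set G S")
  case True
  have "enat (power_domination_number G) \<le> enat (card S) * 1"
    using power_domination_number_le[OF True] by simp
  also have "\<dots> \<le> enat (card S) * propagation_time_of G S"
    by (intro mult_left_mono one_le_propagation_time_of) simp
  finally show ?thesis .
next
  case False
  \<comment> \<open>In \<open>enat\<close>, \<open>0 * \<infinity> = 0\<close>; a positive
    cardinality is what makes the product infinite.\<close>
  have "card S \<noteq> 0"
    using assms finite_subset[OF assms(2)] by simp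
  with False show ?thesis
    by (simp add: propagation_time_of_def imult_is_infinity zero_enat_def)
qed

lemma (in fin_digraph) product_power_throttling_number_eq_domination_number:
  assumes "verts G \<noteq> {}" "power_domination_number G = domination_number G"
  shows "product_power_throttling_number G = enat (domination_number G)"
  unfolding product_power_throttling_number_def
proof (rule Min_eqI)
  show "finite ((\<lambda>S. enat (card S) * propagation_time_of G S) ` {S. S \<noteq> {} \<and> S \<subseteq> verts G})"
    by (rule finite_imageI, rule finite_subset[of _ "Pow (verts G)"]) auto
next
  fix x assume "x \<in> (\<lambda>S. enat (card S) * propagation_time_of G S) ` {S. S \<noteq> {} \<and> S \<subseteq> verts G}"
  then obtain S where "S \<noteq> {}" "S \<subseteq> verts G" "x = enat (card S) * propagation_time_of G S"
    by blast
  then show "enat (domination_number G) \<le> x"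
    using power_domination_number_le_card_times_propagation_time_of[of S] assms(2) by simp
next
  obtain S where S: "dominating_set G S" "card S = domination_number G"
    by (rule minimum_dominating_set)
  \<comment> \<open>A dominating set has time 1, so its product is just its cardinality.\<close>
  then have "enat (domination_number G) = enat (card S) * propagation_time_of G S"
    using propagation_time_of_eq_1_iff[OF assms(1), of S] by simp
  moreover have "S \<noteq> {}" "S \<subseteq> verts G"
    using S(1) dominating_set_nonempty assms(1) by (auto simp: dominating_set_def)
  ultimately show "enat (domination_number G) \<in>
      (\<lambda>S. enat (card S) * propagation_time_of G S) ` {S. S \<noteq> {} \<and> S \<subseteq> verts G}"
    by blast
qed

theorem proposition3p7:
  fixes G :: "('a, 'b) pre_digraph"
  assumes "graph G" and "connected G"
  shows "(power_domination_number G = domination_number G \<longleftrightarrow> propagation_time G = 1) \<and>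
         (power_domination_number G = domination_number G \<longrightarrow>
            product_power_throttling_number G = enat (domination_number G))"
proof -
  interpret graph G by fact
  \<comment> \<open>Nonemptiness is part of \<open>strongly_connected\<close>, through which
    \<open>connected\<close> is defined.\<close>
  have ne: "verts G \<noteq> {}"
    using \<open>connected G\<close> by (auto simp: connected_def strongly_connected_def)
  obtain S where "dominating_set G S" "card S = domination_number G"
    by (rule minimum_dominating_set)
  \<comment> \<open>Left to right, the minimum dominating set is the witness. Conversely, a
    dominating set of size \<gamma>_P gives \<gamma> \<le> \<gamma>_P, and the reverse inequality
    always holds in a nonempty graph.\<close>
  then have "power_domination_number G = domination_number G \<longleftrightarrow>
      (\<exists>S. dominating_set G S \<and> card S = power_domination_number G)"
    using domination_number_le power_domination_number_le_domination_number[OF ne]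
    by (metis antisym)
  then show ?thesis
    using propagation_time_eq_1_iff[OF ne]
      product_power_throttling_number_eq_domination_number[OF ne] by blast
qed

end
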